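(* Let $A_1=(\mathcal{S}_1,\mathcal{E},\mathcal{I}_1,\mathcal{F}_1,\to_1)$ and $A_2=(\mathcal{S}_2,\mathcal{E},\mathcal{I}_2,\mathcal{F}_2,\to_2)$ be Büchi automata over the same set of events. Define the right-biased simulation $$\texttt{fsim}_\texttt{rb}\triangleq\nu X.\ \mu Y.\ \{(s_1,s_2)\mid s_2\in\mathcal{F}_2\wedge\forall e.\forall s_1\xrightarrow{e}_1 s_1'.\exists s_2\xrightarrow{e}_2 s_2'.\ (s_1',s_2')\in X\}\ \cup\ \{(s_1,s_2)\mid \forall e.\forall s_1\xrightarrow{e}_1 s_1'.\exists s_2\xrightarrow{e}_2 s_2'.\ (s_1',s_2')\in Y\}.$$ Then for all $(s_1,s_2)\in\texttt{fsim}_\texttt{rb}$, $\mathit{Traces}_{A_1}(s_1)\subseteq\mathcal{L}_{A_2}(s_2)$.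
   Context: A Büchi automaton $(\mathcal{S},\mathcal{E},\mathcal{I},\mathcal{F},\to)$ consists of a set of states $\mathcal{S}$ (not necessarily finite), a set of events $\mathcal{E}$, initial states $\mathcal{I}\subseteq\mathcal{S}$, accepting states $\mathcal{F}\subseteq\mathcal{S}$, and a labeled transition relation $\to\subseteq\mathcal{S}\times\mathcal{E}\times\mathcal{S}$ (written $s\xrightarrow{e}s'$). $\nu$ and $\mu$ denote greatest and least fixed points of monotone operators on powerset lattices. Traces: $\mathit{Traces}_A\triangleq\nu T.\ \{(s,e\cdot\tau)\mid \exists s\xrightarrow{e}s'.\ (s',\tau)\in T\}\subseteq\mathcal{S}\times\mathcal{E}^\omega$ and $\mathit{Traces}_A(s)\triangleq\{\tau\mid(s,\tau)\in\mathit{Traces}_A\}$ (accepting states are ignored). Language: $\mathcal{L}_A\triangleq\nu L.\ \mu X.\ \{(s,e\cdot\tau)\mid \exists s\xrightarrow{e}s'.\ (s',\tau)\in X\}\cup\{(s,e\cdot\tau)\mid s\in\mathcal{F}\wedge \exists s\xrightarrow{e}s'.\ (s',\tau)\in L\}$ and $\mathcal{L}_A(s)\triangleq\{\tau\mid (s,\tau)\in\mathcal{L}_A\}$. *)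

theory Defs
  imports "HOL-Library.Stream"
begin

record ('s, 'e) buchi =
  states :: "'s set"
  events :: "'e set"
  initial :: "'s set"
  accepting :: "'s set"
  transitions :: "('s \<times> 'e \<times> 's) set"

locale buchi_automaton =
  fixes A :: "('s, 'e) buchi"
  assumes initial_subset: "initial A \<subseteq> states A"
    and accepting_subset: "accepting A \<subseteq> states A"
    and transitions_subset: "transitions A \<subseteq> states A \<times> events A \<times> states A"

text \<open>
  In \<open>trace_rel\<close> and \<open>lang_rel\<close> the fixed points are taken over all sets of pairs. For a
  \<open>buchi_automaton\<close> every pair produced by a transition has its state in \<open>states A\<close> and its first
  event in \<open>events A\<close>, and the successor pair is again in the fixed point, so these are also the
  fixed points over the subsets of \<open>states A \<times> streams (events A)\<close>.
\<close>

definition trace_rel :: "('s, 'e) buchi \<Rightarrow> ('s \<times> 'e stream) set" where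
  "trace_rel A = gfp (\<lambda>T. {(s, e ## \<tau>) | s e \<tau>.
     \<exists>s'. (s, e, s') \<in> transitions A \<and> (s', \<tau>) \<in> T})"

definition Traces :: "('s, 'e) buchi \<Rightarrow> 's \<Rightarrow> 'e stream set" where
  "Traces A s = {\<tau>. (s, \<tau>) \<in> trace_rel A}"

definition lang_rel :: "('s, 'e) buchi \<Rightarrow> ('s \<times> 'e stream) set" where
  "lang_rel A = gfp (\<lambda>L. lfp (\<lambda>X.
     {(s, e ## \<tau>) | s e \<tau>. \<exists>s'. (s, e, s') \<in> transitions A \<and> (s', \<tau>) \<in> X} \<union>
     {(s, e ## \<tau>) | s e \<tau>. s \<in> accepting A \<and>
        (\<exists>s'. (s, e, s') \<in> transitions A \<and> (s', \<tau>) \<in> L)}))"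

definition Lang :: "('s, 'e) buchi \<Rightarrow> 's \<Rightarrow> 'e stream set" where
  "Lang A s = {\<tau>. (s, \<tau>) \<in> lang_rel A}"

text \<open>
  Here the restriction to \<open>states A1 \<times> states A2\<close> has to be explicit: a pair whose first component
  is outside \<open>states A1\<close> has no outgoing transition to match and would satisfy the second condition
  vacuously.
\<close>

definition fsim_rb :: "('s1, 'e) buchi \<Rightarrow> ('s2, 'e) buchi \<Rightarrow> ('s1 \<times> 's2) set" where
  "fsim_rb A1 A2 = gfp (\<lambda>X. lfp (\<lambda>Y.
     {(s1, s2) \<in> states A1 \<times> states A2. s2 \<in> accepting A2 \<and>
        (\<forall>e s1'. (s1, e, s1') \<in> transitions A1 \<longrightarrow>
           (\<exists>s2'. (s2, e, s2') \<in> transitions A2 \<and> (s1', s2') \<in> X))} \<union>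
     {(s1, s2) \<in> states A1 \<times> states A2.
        \<forall>e s1'. (s1, e, s1') \<in> transitions A1 \<longrightarrow>
           (\<exists>s2'. (s2, e, s2') \<in> transitions A2 \<and> (s1', s2') \<in> Y)}))"

end

(* The pairs (s2, \<tau>) such that \<tau> is a trace of some s1 simulated by s2 form a post-fixed point W
   of the operator defining the language. That W lies below the inner least fixed point of that
   operator at W is shown by induction on the inner least fixed point of the simulation: its
   non-accepting steps become steps of the former, and its accepting steps lead back into W. *)
theory Submission
  imports Defs
begin

lemma trace_rel_unfold:
  "(s, \<tau>) \<in> trace_rel A \<longleftrightarrow>
     (\<exists>e \<tau>' s'. \<tau> = e ## \<tau>' \<and> (s, e, s') \<in> transitions A \<and> (s', \<tau>') \<in> trace_rel A)"
proof -
  let ?F = "\<lambda>T. {(s, e ## \<tau>) | s e \<tau>. \<exists>s'. (s, e, s') \<in> transitions A \<and> (s', \<tau>) \<in> T}"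
  have "mono ?F"
    by (rule monoI) blast
  from gfp_unfold[OF this] have "trace_rel A = ?F (trace_rel A)"
    unfolding trace_rel_def .
  then show ?thesis
    by (subst \<open>trace_rel A = _\<close>) blast
qed

text \<open>The operator under both fixed points of \<open>lang_rel\<close>, outer variable first:
  \<open>lfp (lang_step A L)\<close> is the inner fixed point at \<open>L\<close>.\<close>

definition lang_step ::
  "('s, 'e) buchi \<Rightarrow> ('s \<times> 'e stream) set \<Rightarrow> ('s \<times> 'e stream) set \<Rightarrow> ('s \<times> 'e stream) set" where
  "lang_step A L X =
     {(s, e ## \<tau>) | s e \<tau>. \<exists>s'. (s, e, s') \<in> transitions A \<and> (s', \<tau>) \<in> X} \<union>
     {(s, e ## \<tau>) | s e \<tau>. s \<in> accepting A \<and>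
        (\<exists>s'. (s, e, s') \<in> transitions A \<and> (s', \<tau>) \<in> L)}"

lemma lang_rel_coinduct:
  assumes "W \<subseteq> lfp (lang_step A W)"
  shows "W \<subseteq> lang_rel A"
  using assms unfolding lang_rel_def lang_step_def by (rule gfp_upperbound)

lemma lfp_lang_step_unfold: "lfp (lang_step A L) = lang_step A L (lfp (lang_step A L))"
  by (rule lfp_unfold, rule monoI) (unfold lang_step_def, blast)

lemma lfp_lang_step_intros:
  assumes "(s, e, s') \<in> transitions A"
  shows "(s', \<tau>) \<in> lfp (lang_step A L) \<Longrightarrow> (s, e ## \<tau>) \<in> lfp (lang_step A L)"
    and "s \<in> accepting A \<Longrightarrow> (s', \<tau>) \<in> L \<Longrightarrow> (s, e ## \<tau>) \<in> lfp (lang_step A L)"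
  using assms by (subst lfp_lang_step_unfold, auto simp: lang_step_def)+

definition fsim_step ::
  "('s1, 'e) buchi \<Rightarrow> ('s2, 'e) buchi \<Rightarrow> ('s1 \<times> 's2) set \<Rightarrow> ('s1 \<times> 's2) set \<Rightarrow> ('s1 \<times> 's2) set" where
  "fsim_step A1 A2 X Y =
     {(s1, s2) \<in> states A1 \<times> states A2. s2 \<in> accepting A2 \<and>
        (\<forall>e s1'. (s1, e, s1') \<in> transitions A1 \<longrightarrow>
           (\<exists>s2'. (s2, e, s2') \<in> transitions A2 \<and> (s1', s2') \<in> X))} \<union>
     {(s1, s2) \<in> states A1 \<times> states A2.
        \<forall>e s1'. (s1, e, s1') \<in> transitions A1 \<longrightarrow>
           (\<exists>s2'. (s2, e, s2') \<in> transitions A2 \<and> (s1', s2') \<in> Y)}"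

text \<open>One unfolding of the outer greatest fixed point exposes a least one, which makes
  induction available. The outer operator is monotone because \<open>lfp\<close> is monotone in its
  operator.\<close>

lemma fsim_rb_unfold: "fsim_rb A1 A2 = lfp (fsim_step A1 A2 (fsim_rb A1 A2))"
proof -
  have "mono (\<lambda>X. lfp (fsim_step A1 A2 X))"
    by (intro monoI lfp_mono) (unfold fsim_step_def, blast)
  from gfp_unfold[OF this] show ?thesis
    unfolding fsim_rb_def fsim_step_def .
qed

text \<open>Park induction with the outer variable frozen at \<open>fsim_rb A1 A2\<close>: after an
  accepting step the successors are only known to be similar, after any other step they satisfy
  \<open>P\<close>.\<close>

lemma fsim_rb_induct:
  assumes "fsim_step A1 A2 (fsim_rb A1 A2) P \<subseteq> P"
  shows "fsim_rb A1 A2 \<subseteq> P"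
  by (subst fsim_rb_unfold) (rule lfp_lowerbound, rule assms)

lemma fsim_rb_trace_in_lang:
  assumes "(s1, s2) \<in> fsim_rb A1 A2" "(s1, \<tau>) \<in> trace_rel A1"
  shows "(s2, \<tau>) \<in> lang_rel A2"
proof -
  define W where
    "W = {(s2, \<tau>). \<exists>s1. (s1, s2) \<in> fsim_rb A1 A2 \<and> (s1, \<tau>) \<in> trace_rel A1}"
  \<comment> \<open>The trace is quantified inside \<open>P\<close>, since the induction hypothesis
    is applied to its tail.\<close>
  define P where
    "P = {(s1, s2). \<forall>\<tau>. (s1, \<tau>) \<in> trace_rel A1 \<longrightarrow> (s2, \<tau>) \<in> lfp (lang_step A2 W)}"
  have "(s2, \<tau>) \<in> lfp (lang_step A2 W)"
    if step: "(s1, s2) \<in> fsim_step A1 A2 (fsim_rb A1 A2) P" and trace: "(s1, \<tau>) \<in> trace_rel A1"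
    for s1 s2 \<tau>
  proof -
    from trace obtain e \<tau>' s1' where \<tau>: "\<tau> = e ## \<tau>'"
      and s1': "(s1, e, s1') \<in> transitions A1" "(s1', \<tau>') \<in> trace_rel A1"
      using trace_rel_unfold[of s1 \<tau> A1] by blast
    \<comment> \<open>The simulation answers the first transition of the trace with the same event;
      the cases are the two sets united in \<open>fsim_step\<close>.\<close>
    from step consider
        (acc) "s2 \<in> accepting A2"
          "\<exists>s2'. (s2, e, s2') \<in> transitions A2 \<and> (s1', s2') \<in> fsim_rb A1 A2"
      | (other) "\<exists>s2'. (s2, e, s2') \<in> transitions A2 \<and> (s1', s2') \<in> P"
      using s1'(1) unfolding fsim_step_def by blast
    then show ?thesis
    proof cases
      \<comment> \<open>Here \<open>s1'\<close> witnesses that the matching successor, paired with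
        the tail, is in \<open>W\<close>, the outer argument of \<open>lang_step\<close>.\<close>
      case acc
      then show ?thesis
        using s1'(2) unfolding \<tau> by (auto simp: W_def intro: lfp_lang_step_intros(2))
    next
      case other
      then show ?thesis
        using s1'(2) unfolding \<tau> by (auto simp: P_def intro: lfp_lang_step_intros(1))
    qed
  qed
  then have "fsim_step A1 A2 (fsim_rb A1 A2) P \<subseteq> P"
    by (auto simp: P_def)
  then have "fsim_rb A1 A2 \<subseteq> P"
    by (rule fsim_rb_induct)
  \<comment> \<open>The state hidden by the existential in \<open>W\<close> is simulated, so
    \<open>P\<close> holds for it and applies to its trace.\<close>
  then have "W \<subseteq> lfp (lang_step A2 W)"
    by (auto simp: W_def P_def)
  then have "W \<subseteq> lang_rel A2"
    by (rule lang_rel_coinduct)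
  with assms show ?thesis
    by (auto simp: W_def)
qed

theorem theorem4p10:
  fixes A1 :: "('s1, 'e) buchi" and A2 :: "('s2, 'e) buchi"
  assumes "buchi_automaton A1" and "buchi_automaton A2"
    and "events A1 = events A2"
  shows "\<forall>(s1, s2) \<in> fsim_rb A1 A2. Traces A1 s1 \<subseteq> Lang A2 s2"
  by (auto simp: Traces_def Lang_def intro: fsim_rb_trace_in_lang)

end
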